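(* Let $G=(V,E)$ be a finite simple undirected graph with vertex set $V=\{1,\dots,n\}$ and at least one edge. Then $$\chi_v(G)=1+\max_W\left(\frac{\sum_{i\neq j} w_{ij}}{\mathrm{tr}(W)-n\lambda_{\min}(W)}\right),$$ where the maximum (which is attained) is over all non-negative weight matrices $W=(w_{ij})\in\mathbb{R}^{n\times n}$ of $G$ for which the denominator is nonzero (equivalently, $W$ is not a scalar multiple of the identity), the sum is over all ordered pairs $(i,j)$ with $i\ne j$, and $\lambda_{\min}(W)$ denotes the minimum eigenvalue of $W$.
   Context: A non-negative weight matrix of $G$ is a real symmetric matrix $W=(w_{ij})\in\mathbb{R}^{n\times n}$ with all entries $w_{ij}\ge 0$ and with $w_{ij}=0$ whenever $i$ and $j$ are distinct non-adjacent vertices of $G$ (diagonal entries are allowed to be nonzero). For a real number $k\ge 2$, a vector $k$-coloring of $G$ is an assignment of unit vectors $u_i\in\mathbb{R}^n$ to the vertices $i\in V$ such that $\langle u_i,u_j\rangle\le -\frac{1}{k-1}$ for every two adjacent vertices $i,j$. The vector chromatic number $\chi_v(G)$ is the smallest real number $k\ge 2$ for which a vector $k$-coloring of $G$ exists. *)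

theory Defs
  imports "HOL-Analysis.Analysis"
begin

text \<open>
  A graph on \<open>n\<close> labelled vertices is given by its adjacency relation on a finite type
  \<open>'n\<close>; the vertex set is all of \<open>'n\<close>, and \<open>n\<close> is \<open>CARD('n)\<close>.
\<close>

definition simple_graph :: "('n::finite \<times> 'n) set \<Rightarrow> bool" where
  "simple_graph E \<longleftrightarrow> sym E \<and> irrefl E"

definition vector_coloring ::
  "('n::finite \<times> 'n) set \<Rightarrow> real \<Rightarrow> ('n \<Rightarrow> real ^ 'n) \<Rightarrow> bool" where
  "vector_coloring E k u \<longleftrightarrow>
     (\<forall>i. norm (u i) = 1) \<and> (\<forall>i j. (i, j) \<in> E \<longrightarrow> u i \<bullet> u j \<le> - (1 / (k - 1)))"

definition vector_chromatic_number :: "('n::finite \<times> 'n) set \<Rightarrow> real" where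
  "vector_chromatic_number E = (LEAST k. k \<ge> 2 \<and> (\<exists>u. vector_coloring E k u))"

definition weight_matrix :: "('n::finite \<times> 'n) set \<Rightarrow> real ^ 'n ^ 'n \<Rightarrow> bool" where
  "weight_matrix E W \<longleftrightarrow>
     transpose W = W \<and> (\<forall>i j. W $ i $ j \<ge> 0) \<and>
     (\<forall>i j. i \<noteq> j \<and> (i, j) \<notin> E \<longrightarrow> W $ i $ j = 0)"

definition eigenvalue :: "real ^ 'n ^ 'n \<Rightarrow> real \<Rightarrow> bool" where
  "eigenvalue A l \<longleftrightarrow> (\<exists>v. v \<noteq> 0 \<and> A *v v = l *\<^sub>R v)"

text \<open>Only meaningful when \<open>A\<close> has a real eigenvalue, in particular for symmetric \<open>A\<close>.\<close>

definition lambda_min :: "real ^ 'n ^ 'n \<Rightarrow> real" where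
  "lambda_min A = (LEAST l. eigenvalue A l)"

definition weight_denom :: "real ^ 'n ^ 'n \<Rightarrow> real" where
  "weight_denom W = trace W - real CARD('n) * lambda_min W"

definition weight_ratio :: "real ^ 'n ^ 'n \<Rightarrow> real" where
  "weight_ratio W = (\<Sum>(i, j) | i \<noteq> j. W $ i $ j) / weight_denom W"

end

theory Submission
  imports Defs
begin

text \<open>
  Put \<open>s = 1 / (k - 1)\<close>, so that a vector \<open>k\<close>-coloring consists of unit vectors with inner products
  at most \<open>- s\<close> along the edges; by compactness there is a largest such \<open>s\<close>.
  Given a weight matrix \<open>W\<close>, the matrix \<open>W - \<lambda>\<^sub>m\<^sub>i\<^sub>n I\<close> is positive semidefinite, so it pairs
  nonnegatively with the Gram matrix of the coloring; this says that the ratio of \<open>W\<close> is at most \<open>1 / s\<close>.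
  Conversely, let \<open>s\<close> be maximal. The matrices that dominate some Gram matrix on the diagonal and on
  the edges form a convex cone, which contains no matrix with diagonal \<open>1\<close> and off-diagonal entries \<open>- t\<close>
  for \<open>t > s\<close>. The normal of a separating hyperplane, symmetrized, is a positive semidefinite weight
  matrix of ratio at least \<open>1 / s\<close>. The cone is convex because the Gram matrices of \<open>n\<close> vectors in any
  Euclidean space are already realized in dimension \<open>n\<close>.
\<close>

section \<open>Bilinear forms and double sums\<close>

lemma inner_matrix_vector_mult:
  fixes A :: "real ^ 'n ^ 'n"
  shows "x \<bullet> (A *v y) = (\<Sum>i\<in>UNIV. \<Sum>j\<in>UNIV. A $ i $ j * (x $ i * y $ j))"
  by (simp add: inner_vec_def matrix_vector_mult_def sum_distrib_left mult_ac)

lemma inner_symmetric_matrix: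
  fixes A :: "real ^ 'n ^ 'n"
  assumes "transpose A = A"
  shows "x \<bullet> (A *v y) = y \<bullet> (A *v x)"
  by (metis assms dot_lmul_matrix inner_commute transpose_matrix_vector)

lemma sum_diag_offdiag:
  fixes f :: "'n::finite \<Rightarrow> 'n \<Rightarrow> real"
  shows "(\<Sum>i\<in>UNIV. \<Sum>j\<in>UNIV. f i j) = (\<Sum>i\<in>UNIV. f i i) + (\<Sum>(i, j) | i \<noteq> j. f i j)"
proof -
  have "(\<Sum>i\<in>UNIV. \<Sum>j\<in>UNIV. f i j) = (\<Sum>(i, j)\<in>UNIV. f i j)"
    by (simp add: sum.cartesian_product)
  also have "\<dots> = (\<Sum>(i, j) | i = j. f i j) + (\<Sum>(i, j) | i \<noteq> j. f i j)"
    by (subst sum.union_disjoint [symmetric]) (auto intro!: sum.cong)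
  also have "(\<Sum>(i, j) | i = j. f i j) = (\<Sum>i\<in>UNIV. f i i)"
    by (rule sum.reindex_bij_witness[of _ "\<lambda>i. (i, i)" fst]) auto
  finally show ?thesis .
qed

section \<open>The least eigenvalue of a symmetric matrix\<close>

text \<open>A zero of a nonnegative form is a minimum. Moving from \<open>v\<close> in direction
  \<open>- (A *v v)\<close> changes the form to first order by \<open>-2\<close> times the squared
  length of \<open>A *v v\<close>, so a nonzero \<open>A *v v\<close> would make it
  negative.\<close>

lemma psd_form_zero_imp_kernel:
  fixes A :: "real ^ 'n ^ 'n"
  assumes sym: "transpose A = A" and psd: "\<And>x. 0 \<le> x \<bullet> (A *v x)"
    and v: "v \<bullet> (A *v v) = 0"
  shows "A *v v = 0"
proof (rule ccontr)
  define y where "y = A *v v"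
  assume "A *v v \<noteq> 0"
  then have y: "y \<bullet> y > 0" by (simp add: y_def)
  define c where "c = y \<bullet> (A *v y)"
  have c: "0 \<le> c" unfolding c_def by (rule psd)
  \<comment> \<open>The step size makes the quadratic term \<open>t * c\<close> at most
    \<open>y \<bullet> y\<close>, so it cannot outweigh the linear term
    \<open>2 * (y \<bullet> y)\<close>. The \<open>+ 1\<close> keeps the denominator positive when
    \<open>c = 0\<close>.\<close>
  define t where "t = (y \<bullet> y) / (c + 1)"
  have t: "t > 0" "t * c \<le> y \<bullet> y" using c y by (auto simp: t_def field_simps)
  have "0 \<le> (v - t *\<^sub>R y) \<bullet> (A *v (v - t *\<^sub>R y))" by (rule psd)
  also have "\<dots> = t * (t * c - 2 * (y \<bullet> y))"
    using v inner_symmetric_matrix[OF sym, of v y]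
    by (simp add: c_def y_def[symmetric] matrix_vector_mult_diff_distrib inner_diff_left inner_diff_right
        matrix_vector_mult_scaleR algebra_simps)
  finally show False
    using t y by (simp add: zero_le_mult_iff)
qed

lemma matrix_shift_mult:
  fixes A :: "real ^ 'n ^ 'n"
  shows "(A - c *\<^sub>R mat 1) *v x = A *v x - c *\<^sub>R x"
  by (simp add: matrix_vector_mult_diff_rdistrib scaleR_matrix_vector_assoc [symmetric])

lemma transpose_shift:
  fixes A :: "real ^ 'n ^ 'n"
  assumes "transpose A = A"
  shows "transpose (A - c *\<^sub>R mat 1) = A - c *\<^sub>R mat 1"
  using assms by (auto simp: transpose_def vec_eq_iff mat_def)

text \<open>The quadratic form attains a minimum \<open>l\<close> on the unit sphere. Subtracting
  \<open>l\<close> times the identity leaves a positive semidefinite matrix whose form vanishes at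
  the minimizer, so the minimizer lies in its kernel and is an eigenvector.\<close>

lemma least_eigenvalue_exists:
  fixes A :: "real ^ 'n ^ 'n"
  assumes sym: "transpose A = A"
  shows "\<exists>l. eigenvalue A l \<and> (\<forall>x. l * (x \<bullet> x) \<le> x \<bullet> (A *v x))"
proof -
  let ?q = "\<lambda>x. x \<bullet> (A *v x)"
  have cont: "continuous_on (sphere 0 1) ?q"
    by (intro continuous_intros matrix_vector_mult_linear_continuous_on)
  have "sphere 0 1 \<noteq> ({} :: (real ^ 'n) set)" by simp
  then obtain v where v: "v \<in> sphere 0 1" and min: "\<And>x. x \<in> sphere 0 1 \<Longrightarrow> ?q v \<le> ?q x"
    using continuous_attains_inf[OF compact_sphere _ cont] by blast
  define l where "l = ?q v"
  have vv: "v \<bullet> v = 1" using v by (simp add: dot_square_norm)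
  have ray: "l * (x \<bullet> x) \<le> ?q x" for x
  proof (cases "x = 0")
    case False
    then have "x /\<^sub>R norm x \<in> sphere 0 1" by simp
    then have "l \<le> ?q (x /\<^sub>R norm x)" unfolding l_def by (rule min)
    also have "\<dots> = ?q x / (x \<bullet> x)"
      by (simp add: matrix_vector_mult_scaleR dot_square_norm power2_eq_square divide_simps)
    finally show ?thesis using False by (simp add: field_simps)
  qed simp
  have "(A - l *\<^sub>R mat 1) *v v = 0"
    by (rule psd_form_zero_imp_kernel[OF transpose_shift[OF sym]])
      (use ray vv in \<open>simp_all add: matrix_shift_mult inner_diff_right l_def\<close>)
  then have "A *v v = l *\<^sub>R v" by (simp add: matrix_shift_mult)
  moreover have "v \<noteq> 0" using vv by auto
  ultimately show ?thesis using ray by (auto simp: eigenvalue_def)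
qed

text \<open>The \<open>LEAST\<close> in \<open>lambda_min\<close> is attained: the minimum of the
  Rayleigh quotient is an eigenvalue, and every eigenvalue is the Rayleigh quotient of its
  eigenvector.\<close>

lemma
  fixes A :: "real ^ 'n ^ 'n"
  assumes sym: "transpose A = A"
  shows eigenvalue_lambda_min: "eigenvalue A (lambda_min A)"
    and lambda_min_rayleigh: "lambda_min A * (x \<bullet> x) \<le> x \<bullet> (A *v x)"
proof -
  obtain l where l: "eigenvalue A l" "\<And>x. l * (x \<bullet> x) \<le> x \<bullet> (A *v x)"
    using least_eigenvalue_exists[OF sym] by blast
  have "lambda_min A = l"
    unfolding lambda_min_def
  proof (rule Least_equality)
    show "eigenvalue A l" by (rule l(1))
    fix m assume "eigenvalue A m"
    then obtain v where v: "v \<noteq> 0" "A *v v = m *\<^sub>R v" by (auto simp: eigenvalue_def)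
    with l(2)[of v] show "l \<le> m" by simp
  qed
  with l show "eigenvalue A (lambda_min A)" "lambda_min A * (x \<bullet> x) \<le> x \<bullet> (A *v x)" by auto
qed

lemma shift_lambda_min_psd:
  fixes A :: "real ^ 'n ^ 'n"
  assumes "transpose A = A"
  shows "0 \<le> x \<bullet> ((A - lambda_min A *\<^sub>R mat 1) *v x)"
  using lambda_min_rayleigh[OF assms, of x] by (simp add: matrix_shift_mult inner_diff_right)

lemma lambda_min_nonneg:
  fixes A :: "real ^ 'n ^ 'n"
  assumes "transpose A = A" and "\<And>x. 0 \<le> x \<bullet> (A *v x)"
  shows "0 \<le> lambda_min A"
proof -
  obtain v where v: "v \<noteq> 0" "A *v v = lambda_min A *\<^sub>R v"
    using eigenvalue_lambda_min[OF assms(1)] by (auto simp: eigenvalue_def)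
  with assms(2)[of v] show ?thesis
    by (metis inner_gt_zero_iff inner_scaleR_right zero_le_mult_iff not_le)
qed

lemma lambda_min_scaled_identity: "lambda_min (c *\<^sub>R mat 1 :: real ^ 'n ^ 'n) = c"
proof -
  have "transpose (c *\<^sub>R mat 1 :: real ^ 'n ^ 'n) = c *\<^sub>R mat 1"
    by (auto simp: transpose_def vec_eq_iff mat_def)
  from eigenvalue_lambda_min[OF this] show ?thesis
    by (auto simp: eigenvalue_def scaleR_matrix_vector_assoc [symmetric])
qed

lemma lambda_min_le_diag:
  fixes A :: "real ^ 'n ^ 'n"
  assumes "transpose A = A"
  shows "lambda_min A \<le> A $ i $ i"
  using lambda_min_rayleigh[OF assms, of "axis i 1"]
  by (simp add: inner_axis_axis inner_axis' matrix_vector_mult_basis column_def)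

lemma weight_denom_sum: "weight_denom A = (\<Sum>i\<in>UNIV. A $ i $ i - lambda_min A)"
  by (simp add: weight_denom_def trace_def sum_subtractf)

lemma weight_denom_nonneg:
  assumes "transpose A = A"
  shows "0 \<le> weight_denom A"
  unfolding weight_denom_sum by (rule sum_nonneg) (use lambda_min_le_diag[OF assms] in simp)

text \<open>The denominator sums the diagonal entries of the positive semidefinite matrix
  \<open>?M\<close>. If they all vanish, the form of \<open>?M\<close> vanishes at each basis
  vector, so each column of \<open>?M\<close> is zero.\<close>

lemma weight_denom_zero_iff:
  assumes sym: "transpose A = A"
  shows "weight_denom A = 0 \<longleftrightarrow> (\<exists>c. A = c *\<^sub>R mat 1)"
proof
  let ?M = "A - lambda_min A *\<^sub>R mat 1"
  assume "weight_denom A = 0"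
  then have diag: "A $ i $ i = lambda_min A" for i
    using lambda_min_le_diag[OF sym] by (simp add: weight_denom_sum sum_nonneg_eq_0_iff)
  have "?M *v axis i 1 = 0" for i
    by (rule psd_form_zero_imp_kernel[OF transpose_shift[OF sym] shift_lambda_min_psd[OF sym]])
      (simp add: inner_axis' matrix_vector_mult_basis column_def diag mat_def)
  then have "?M $ j $ i = 0" for i j
    by (simp add: matrix_vector_mult_basis column_def vec_eq_iff)
  then have "A = lambda_min A *\<^sub>R mat 1"
    by (simp add: vec_eq_iff)
  then show "\<exists>c. A = c *\<^sub>R mat 1" by blast
next
  assume "\<exists>c. A = c *\<^sub>R mat 1"
  then show "weight_denom A = 0"
    by (auto simp: weight_denom_sum lambda_min_scaled_identity) (simp add: mat_def)
qed

section \<open>Gram vectors and colorings\<close>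

text \<open>A Gram matrix is a sum of rank-one matrices, one for each coordinate \<open>k\<close>,
  formed from the vector of all \<open>k\<close>-th coordinates; each contributes one value of the
  quadratic form.\<close>

lemma psd_gram_sum_nonneg:
  fixes A :: "real ^ 'n ^ 'n" and u :: "'n \<Rightarrow> real ^ 'm"
  assumes "\<And>x. 0 \<le> x \<bullet> (A *v x)"
  shows "0 \<le> (\<Sum>i\<in>UNIV. \<Sum>j\<in>UNIV. A $ i $ j * (u i \<bullet> u j))"
proof -
  have "0 \<le> (\<Sum>k\<in>UNIV. (\<chi> i. u i $ k) \<bullet> (A *v (\<chi> i. u i $ k)))"
    by (intro sum_nonneg assms)
  also have "\<dots> = (\<Sum>k\<in>UNIV. \<Sum>i\<in>UNIV. \<Sum>j\<in>UNIV. A $ i $ j * (u i $ k * u j $ k))"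
    by (simp add: inner_matrix_vector_mult)
  also have "\<dots> = (\<Sum>i\<in>UNIV. \<Sum>k\<in>UNIV. \<Sum>j\<in>UNIV. A $ i $ j * (u i $ k * u j $ k))"
    by (rule sum.swap)
  also have "\<dots> = (\<Sum>i\<in>UNIV. \<Sum>j\<in>UNIV. \<Sum>k\<in>UNIV. A $ i $ j * (u i $ k * u j $ k))"
    by (rule sum.cong[OF refl], rule sum.swap)
  also have "\<dots> = (\<Sum>i\<in>UNIV. \<Sum>j\<in>UNIV. A $ i $ j * (u i \<bullet> u j))"
    by (simp add: inner_vec_def sum_distrib_left)
  finally show ?thesis .
qed

text \<open>The span of \<open>n\<close> vectors has dimension at most \<open>n\<close>, so it
  embeds isometrically into \<open>real ^ 'n\<close>; polarization turns preserved norms into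
  preserved inner products.\<close>

lemma gram_vectors_in_low_dim:
  fixes f :: "'n::finite \<Rightarrow> 'a::euclidean_space"
  obtains u :: "'n \<Rightarrow> real ^ 'n" where "\<And>i j. u i \<bullet> u j = f i \<bullet> f j"
proof -
  let ?S = "span (range f)"
  have "dim ?S \<le> card (range f)" by (simp add: dim_le_card')
  also have "\<dots> \<le> CARD('n)" by (simp add: card_image_le)
  finally have "dim ?S \<le> dim (UNIV :: (real ^ 'n) set)" by simp
  then obtain g :: "'a \<Rightarrow> real ^ 'n" where g: "linear g" "\<And>x. x \<in> ?S \<Longrightarrow> norm (g x) = norm x"
    using isometry_subset_subspace[OF subspace_span subspace_UNIV] by metis
  have "g (f i) \<bullet> g (f j) = f i \<bullet> f j" for i j
    by (simp add: dot_norm linear_add[OF g(1), symmetric] g(2) span_add span_base)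
  then show ?thesis by (rule that)
qed

definition obtuse_vectors :: "('n::finite \<times> 'n) set \<Rightarrow> real \<Rightarrow> ('n \<Rightarrow> real ^ 'n) \<Rightarrow> bool" where
  "obtuse_vectors E s u \<longleftrightarrow> (\<forall>i. norm (u i) = 1) \<and> (\<forall>i j. (i, j) \<in> E \<longrightarrow> u i \<bullet> u j \<le> - s)"

text \<open>Short vectors in any Euclidean space suffice: each is extended to unit length along an
  axis of its own, which leaves inner products between distinct vertices unchanged, and the
  dimension is then reduced.\<close>

lemma obtuse_vectorsI:
  fixes f :: "'n::finite \<Rightarrow> 'a::euclidean_space"
  assumes E: "irrefl E" and f1: "\<And>i. f i \<bullet> f i \<le> 1" and fE: "\<And>i j. (i, j) \<in> E \<Longrightarrow> f i \<bullet> f j \<le> - s"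
  shows "\<exists>u. obtuse_vectors E s u"
proof -
  define g where "g i = (f i, axis i (sqrt (1 - f i \<bullet> f i)) :: real ^ 'n)" for i
  obtain u :: "'n \<Rightarrow> real ^ 'n" where u: "\<And>i j. u i \<bullet> u j = g i \<bullet> g j"
    using gram_vectors_in_low_dim[of g] by blast
  have "norm (u i) = 1" for i
    using f1[of i] by (simp add: norm_eq_1 u g_def inner_axis_axis)
  moreover have "u i \<bullet> u j \<le> - s" if "(i, j) \<in> E" for i j
  proof -
    have "i \<noteq> j" using that E by (auto simp: irrefl_def)
    then show ?thesis using fE[OF that] by (simp add: u g_def inner_axis_axis)
  qed
  ultimately show ?thesis by (auto simp: obtuse_vectors_def)
qed

lemma obtuse_vectors_le_1:
  assumes "obtuse_vectors E s u" and "E \<noteq> {}"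
  shows "s \<le> 1"
proof -
  obtain i j where "(i, j) \<in> E" using assms(2) by auto
  then have "s \<le> - (u i \<bullet> u j)" "norm (u i) = 1" "norm (u j) = 1"
    using assms(1) by (force simp: obtuse_vectors_def)+
  with Cauchy_Schwarz_ineq2[of "u i" "u j"] show ?thesis by simp
qed

text \<open>A starting point that makes the optimal \<open>s\<close> positive: basis vectors
  translated by their centroid form a regular simplex centred at the origin.\<close>

lemma obtuse_vectors_simplex:
  fixes E :: "('n::finite \<times> 'n) set"
  assumes "irrefl E"
  shows "\<exists>u. obtuse_vectors E (1 / CARD('n)) u"
proof (rule obtuse_vectorsI[OF assms])
  define f :: "'n \<Rightarrow> real ^ 'n" where "f i = axis i 1 - (\<chi> j. 1 / CARD('n))" for i
  have f: "f i \<bullet> f j = (if i = j then 1 else 0) - 1 / CARD('n)" for i j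
    by (simp add: f_def inner_diff_left inner_diff_right inner_axis inner_axis' inner_vec_def[of "vec_lambda _" "vec_lambda _"])
      (simp add: axis_def)
  show "f i \<bullet> f i \<le> 1" for i by (simp add: f)
  show "f i \<bullet> f j \<le> - (1 / CARD('n))" if "(i, j) \<in> E" for i j
    using that assms by (auto simp: f irrefl_def)
qed

lemma max_obtuse_vectors:
  fixes E :: "('n::finite \<times> 'n) set"
  assumes E: "irrefl E" "E \<noteq> {}"
  obtains s u where "0 < s" "s \<le> 1" "obtuse_vectors E s u" "\<And>t v. obtuse_vectors E t v \<Longrightarrow> t \<le> s"
proof -
  \<comment> \<open>The vectors become the rows of a matrix, so that compactness in a Euclidean
    space applies. The bound \<open>snd p \<le> 1\<close> excludes no obtuse system, by
    Cauchy-Schwarz on an edge.\<close>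
  define K :: "((real ^ 'n ^ 'n) \<times> real) set" where
    "K = {p. (\<forall>i. norm (fst p $ i) = 1) \<and> (\<forall>i j. (i, j) \<in> E \<longrightarrow> fst p $ i \<bullet> fst p $ j \<le> - snd p) \<and>
             0 \<le> snd p \<and> snd p \<le> 1}"
  have K: "(U, t) \<in> K \<longleftrightarrow> obtuse_vectors E t (($) U) \<and> 0 \<le> t" for U t
    using obtuse_vectors_le_1[of E t "($) U"] E(2) by (auto simp: K_def obtuse_vectors_def)
  have K': "(vec_lambda v, t) \<in> K \<longleftrightarrow> obtuse_vectors E t v \<and> 0 \<le> t" for v t
    unfolding K by (simp add: vec_lambda_inverse)
  have "closed K"
    unfolding K_def
    by (intro closed_Collect_conj closed_Collect_all closed_Collect_imp open_Collect_const closed_Collect_eq closed_Collect_le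
        continuous_intros)
  moreover have "norm p \<le> CARD('n) + 1" if "p \<in> K" for p
  proof -
    have "norm (fst p) \<le> (\<Sum>i\<in>UNIV. norm (fst p $ i))"
      unfolding norm_vec_def by (rule L2_set_le_sum) simp
    also have "\<dots> = CARD('n)" using that by (simp add: K_def)
    finally have "norm (fst p) \<le> CARD('n)" .
    moreover have "norm (snd p) \<le> 1" using that by (simp add: K_def)
    ultimately show ?thesis using norm_Pair_le[of "fst p" "snd p"] by simp
  qed
  ultimately have comp: "compact K"
    unfolding compact_eq_bounded_closed bounded_iff by blast
  obtain v0 where v0: "obtuse_vectors E (1 / CARD('n)) v0"
    using obtuse_vectors_simplex[OF E(1)] by blast
  then have mem: "(vec_lambda v0, 1 / CARD('n)) \<in> K" by (simp add: K')
  have "continuous_on K snd" by (intro continuous_intros)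
  with comp mem obtain p where p: "p \<in> K" and max: "\<And>q. q \<in> K \<Longrightarrow> snd q \<le> snd p"
    using continuous_attains_sup[of K snd] by blast
  have ob: "obtuse_vectors E (snd p) (($) (fst p))" and "snd p \<le> 1"
    using p K[of "fst p" "snd p"] by (auto simp: K_def)
  \<comment> \<open>The simplex system lies in \<open>K\<close>, so the maximum is at least
    \<open>1 / CARD('n)\<close>.\<close>
  have pos: "0 < snd p"
    using max[OF mem] by (rule order.strict_trans2[rotated]) simp
  moreover have "t \<le> snd p" if "obtuse_vectors E t v" for t v
    using max[of "(vec_lambda v, t)"] that pos by (cases "0 \<le> t") (auto simp: K')
  ultimately show ?thesis using that ob \<open>snd p \<le> 1\<close> by blast
qed

lemma vector_coloring_iff_obtuse: "vector_coloring E k u \<longleftrightarrow> obtuse_vectors E (1 / (k - 1)) u"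
  by (simp add: vector_coloring_def obtuse_vectors_def)

text \<open>The map from \<open>k\<close> to \<open>1 / (k - 1)\<close> reverses order, so an
  attained maximal \<open>s\<close> gives an attained least \<open>k\<close>;
  \<open>s \<le> 1\<close> corresponds to \<open>k \<ge> 2\<close>.\<close>

lemma vector_chromatic_number_eq:
  assumes "0 < s" "s \<le> 1" "obtuse_vectors E s u" "\<And>t v. obtuse_vectors E t v \<Longrightarrow> t \<le> s"
  shows "vector_chromatic_number E = 1 + 1 / s"
  unfolding vector_chromatic_number_def
proof (rule Least_equality)
  show "1 + 1 / s \<ge> 2 \<and> (\<exists>u. vector_coloring E (1 + 1 / s) u)"
    using assms(1-3) by (auto simp: vector_coloring_iff_obtuse)
  fix k assume k: "2 \<le> k \<and> (\<exists>u. vector_coloring E k u)"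
  then have "1 / (k - 1) \<le> s" using assms(4) by (auto simp: vector_coloring_iff_obtuse)
  with k assms(1) show "1 + 1 / s \<le> k" by (simp add: field_simps)
qed

section \<open>Duality\<close>

text \<open>Weak duality. In the pairing of \<open>?M\<close> with the Gram matrix, unit length
  turns the diagonal into the denominator, each edge contributes at most \<open>- s\<close> times
  its weight, and non-edges contribute nothing.\<close>

lemma weight_ratio_le:
  assumes ob: "obtuse_vectors E s u" and s: "0 < s" and W: "weight_matrix E W" and den: "weight_denom W \<noteq> 0"
  shows "weight_ratio W \<le> 1 / s"
proof -
  have sym: "transpose W = W" using W by (simp add: weight_matrix_def)
  let ?M = "W - lambda_min W *\<^sub>R mat 1"
  let ?off = "\<Sum>(i, j) | i \<noteq> j. W $ i $ j"
  have pos: "weight_denom W > 0" using weight_denom_nonneg[OF sym] den by simp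
  have "0 \<le> (\<Sum>i\<in>UNIV. \<Sum>j\<in>UNIV. ?M $ i $ j * (u i \<bullet> u j))"
    by (rule psd_gram_sum_nonneg[OF shift_lambda_min_psd[OF sym]])
  also have "\<dots> = (\<Sum>i\<in>UNIV. ?M $ i $ i * (u i \<bullet> u i)) + (\<Sum>(i, j) | i \<noteq> j. ?M $ i $ j * (u i \<bullet> u j))"
    by (rule sum_diag_offdiag)
  also have "(\<Sum>i\<in>UNIV. ?M $ i $ i * (u i \<bullet> u i)) = weight_denom W"
    using ob by (simp add: weight_denom_sum obtuse_vectors_def dot_square_norm mat_def)
  also have "(\<Sum>(i, j) | i \<noteq> j. ?M $ i $ j * (u i \<bullet> u j)) \<le> (\<Sum>(i, j) | i \<noteq> j. W $ i $ j * (- s))"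
  proof (rule sum_mono, clarify)
    fix i j :: 'a assume ij: "i \<noteq> j"
    show "?M $ i $ j * (u i \<bullet> u j) \<le> W $ i $ j * (- s)"
    proof (cases "(i, j) \<in> E")
      case True
      then have "u i \<bullet> u j \<le> - s" "W $ i $ j \<ge> 0" using ob W by (auto simp: obtuse_vectors_def weight_matrix_def)
      then show ?thesis using ij mult_left_mono[of "u i \<bullet> u j" "- s" "W $ i $ j"] by (simp add: mat_def)
    next
      case False
      then have "W $ i $ j = 0" using W ij by (simp add: weight_matrix_def)
      then show ?thesis using ij by (simp add: mat_def)
    qed
  qed
  also have "(\<Sum>(i, j) | i \<noteq> j. W $ i $ j * (- s)) = - (s * ?off)"
    by (simp add: sum_distrib_left sum_negf split_def mult.commute)
  finally have "s * ?off \<le> weight_denom W" by simp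
  then show ?thesis using s pos by (simp add: weight_ratio_def field_simps)
qed

section \<open>The cone of matrices dominating a Gram matrix, and its dual\<close>

text \<open>Off-diagonal entries at non-edges are left free, which forces a dual matrix to vanish
  there; closure under increasing the other entries forces nonnegativity. Symmetry is not
  imposed.\<close>

definition gram_cone :: "('n::finite \<times> 'n) set \<Rightarrow> (real ^ 'n ^ 'n) set" where
  "gram_cone E = {Y. \<exists>u :: 'n \<Rightarrow> real ^ 'n. (\<forall>i. u i \<bullet> u i \<le> Y $ i $ i) \<and> (\<forall>i j. (i, j) \<in> E \<longrightarrow> u i \<bullet> u j \<le> Y $ i $ j)}"

lemma gram_coneI:
  fixes f :: "'n::finite \<Rightarrow> 'a::euclidean_space"
  assumes "\<And>i. f i \<bullet> f i \<le> Y $ i $ i" and "\<And>i j. (i, j) \<in> E \<Longrightarrow> f i \<bullet> f j \<le> Y $ i $ j"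
  shows "Y \<in> gram_cone E"
proof -
  obtain u :: "'n \<Rightarrow> real ^ 'n" where u: "\<And>i j. u i \<bullet> u j = f i \<bullet> f j"
    using gram_vectors_in_low_dim[of f] by blast
  show ?thesis unfolding gram_cone_def using assms by (auto simp: u intro!: exI[of _ u])
qed

lemma gram_coneE:
  assumes "Y \<in> gram_cone E"
  obtains u :: "'n::finite \<Rightarrow> real ^ 'n"
  where "\<And>i. u i \<bullet> u i \<le> Y $ i $ i" "\<And>i j. (i, j) \<in> E \<Longrightarrow> u i \<bullet> u j \<le> Y $ i $ j"
  using assms unfolding gram_cone_def by blast

text \<open>Concatenating the vectors of two systems adds their Gram matrices;
  \<open>gram_coneI\<close> absorbs the doubled dimension.\<close>

lemma gram_cone_add:
  assumes "X \<in> gram_cone E" and "Y \<in> gram_cone E"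
  shows "X + Y \<in> gram_cone E"
proof -
  obtain u :: "'a \<Rightarrow> real ^ 'a" where u: "\<And>i. u i \<bullet> u i \<le> X $ i $ i"
    "\<And>i j. (i, j) \<in> E \<Longrightarrow> u i \<bullet> u j \<le> X $ i $ j"
    using gram_coneE[OF assms(1)] by blast
  obtain v :: "'a \<Rightarrow> real ^ 'a" where v: "\<And>i. v i \<bullet> v i \<le> Y $ i $ i"
    "\<And>i j. (i, j) \<in> E \<Longrightarrow> v i \<bullet> v j \<le> Y $ i $ j"
    using gram_coneE[OF assms(2)] by blast
  show ?thesis
    by (rule gram_coneI[of "\<lambda>i. (u i, v i)"]) (simp_all add: u v add_mono)
qed

lemma gram_cone_scaleR:
  assumes "X \<in> gram_cone E" and c: "0 \<le> c"
  shows "c *\<^sub>R X \<in> gram_cone E"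
proof -
  obtain u :: "'a \<Rightarrow> real ^ 'a" where u: "\<And>i. u i \<bullet> u i \<le> X $ i $ i"
    "\<And>i j. (i, j) \<in> E \<Longrightarrow> u i \<bullet> u j \<le> X $ i $ j"
    using gram_coneE[OF assms(1)] by blast
  have [simp]: "sqrt c * (sqrt c * x) = c * x" for x using c by (simp add: mult.assoc[symmetric])
  show ?thesis
    by (rule gram_coneI[of "\<lambda>i. sqrt c *\<^sub>R u i"]) (simp_all add: u c mult_left_mono)
qed

lemma convex_gram_cone: "convex (gram_cone E)"
  by (auto simp: convex_def intro!: gram_cone_add gram_cone_scaleR)

lemma inner_matrix_sum:
  fixes A B :: "real ^ 'n ^ 'm"
  shows "A \<bullet> B = (\<Sum>i\<in>UNIV. \<Sum>j\<in>UNIV. A $ i $ j * B $ i $ j)"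
  by (simp add: inner_vec_def)

text \<open>Each property comes from testing against suitable members of the cone: rank-one
  matrices, matrix units on the diagonal and the edges, and matrix units of both signs at
  non-edges.\<close>

lemma dual_cone_gram_cone:
  fixes A :: "real ^ 'n ^ 'n"
  assumes dual: "\<And>Y. Y \<in> gram_cone E \<Longrightarrow> 0 \<le> A \<bullet> Y"
  shows "0 \<le> x \<bullet> (A *v x)"
    and "i = j \<or> (i, j) \<in> E \<Longrightarrow> 0 \<le> A $ i $ j"
    and "i \<noteq> j \<Longrightarrow> (i, j) \<notin> E \<Longrightarrow> A $ i $ j = 0"
proof -
  \<comment> \<open>The entries of \<open>x\<close>, taken as vectors in dimension one, have exactly
    this Gram matrix.\<close>
  have "(\<chi> i j. x $ i * x $ j) \<in> gram_cone E"
    by (rule gram_coneI[of "\<lambda>i. x $ i"]) simp_all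
  from dual[OF this] show "0 \<le> x \<bullet> (A *v x)"
    by (simp add: inner_matrix_sum inner_matrix_vector_mult)
  have unit: "A \<bullet> axis i (axis j c) = c * A $ i $ j" for c i j
    by (simp add: inner_axis)
  have entry: "(axis i (axis j c) :: real ^ 'n ^ 'n) $ k $ l = (if i = k \<and> j = l then c else 0)" for i j k l c
    by (auto simp: axis_def)
  show "0 \<le> A $ i $ j" if "i = j \<or> (i, j) \<in> E"
  proof -
    have "axis i (axis j 1) \<in> gram_cone E"
      by (rule gram_coneI[of "\<lambda>i. 0 :: real"]) (simp_all add: entry)
    from dual[OF this] show ?thesis by (simp add: unit)
  qed
  show "A $ i $ j = 0" if "i \<noteq> j" "(i, j) \<notin> E"
  proof -
    have "axis i (axis j c) \<in> gram_cone E" for c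
      by (rule gram_coneI[of "\<lambda>i. 0 :: real"]) (use that in \<open>auto simp: entry\<close>)
    from dual[OF this[of 1]] dual[OF this[of "- 1"]] show ?thesis by (simp add: unit)
  qed
qed

section \<open>Separation and the optimal weight matrix\<close>

text \<open>The uniform off-diagonal value makes the pairing with a matrix its trace minus
  \<open>s\<close> times its off-diagonal sum, the two quantities compared in the ratio.\<close>

definition obtuse_target :: "real \<Rightarrow> real ^ 'n ^ 'n" where
  "obtuse_target s = (\<chi> i j. if i = j then 1 else - s)"

lemma obtuse_target_in_gram_cone:
  fixes E :: "('n::finite \<times> 'n) set"
  assumes "irrefl E" and "obtuse_target s \<in> gram_cone E"
  shows "\<exists>u. obtuse_vectors E s u"
proof -
  obtain u :: "'n \<Rightarrow> real ^ 'n" where u: "\<And>i. u i \<bullet> u i \<le> obtuse_target s $ i $ i"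
    "\<And>i j. (i, j) \<in> E \<Longrightarrow> u i \<bullet> u j \<le> obtuse_target s $ i $ j"
    using gram_coneE[OF assms(2)] by blast
  show ?thesis
  proof (rule obtuse_vectorsI[OF assms(1)])
    show "u i \<bullet> u i \<le> 1" for i using u(1)[of i] by (simp add: obtuse_target_def)
    fix i j assume ij: "(i, j) \<in> E"
    then have "i \<noteq> j" using assms(1) by (auto simp: irrefl_def)
    then show "u i \<bullet> u j \<le> - s" using u(2)[OF ij] by (simp add: obtuse_target_def)
  qed
qed

lemma inner_obtuse_target:
  fixes A :: "real ^ 'n ^ 'n"
  shows "A \<bullet> obtuse_target s = trace A - s * (\<Sum>(i, j) | i \<noteq> j. A $ i $ j)"
proof -
  have "(\<Sum>(i, j) | i \<noteq> j. A $ i $ j * obtuse_target s $ i $ j) = (\<Sum>(i, j) | i \<noteq> j. - s * A $ i $ j)"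
    by (rule sum.cong) (auto simp: obtuse_target_def)
  then show ?thesis
    by (simp add: inner_matrix_sum sum_diag_offdiag trace_def sum_distrib_left split_def)
      (simp add: obtuse_target_def sum_negf)
qed

lemma convex_obtuse_targets: "convex (obtuse_target ` {s<..} :: (real ^ 'n ^ 'n) set)"
proof -
  have "obtuse_target ` {s<..} = (+) (obtuse_target 0) ` (\<lambda>t. t *\<^sub>R (obtuse_target 1 - obtuse_target 0)) ` {s<..}"
    unfolding image_image
    by (rule image_cong) (auto simp: obtuse_target_def vec_eq_iff)
  also have "convex \<dots>"
    by (intro convex_translation convex_linear_image) (auto intro!: linearI simp: algebra_simps)
  finally show ?thesis .
qed

text \<open>Targets with parameter beyond \<open>s\<close> form a convex set disjoint from the cone.
  The negated normal of a separating hyperplane is nonnegative on the cone and satisfies the trace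
  inequality for every \<open>t > s\<close>, hence also in the limit.\<close>

lemma dual_certificate:
  fixes E :: "('n::finite \<times> 'n) set"
  assumes E: "irrefl E" and max: "\<And>t v. obtuse_vectors E t v \<Longrightarrow> t \<le> s"
  obtains A :: "real ^ 'n ^ 'n" where "A \<noteq> 0" "\<And>Y. Y \<in> gram_cone E \<Longrightarrow> 0 \<le> A \<bullet> Y"
    "trace A \<le> s * (\<Sum>(i, j) | i \<noteq> j. A $ i $ j)"
proof -
  let ?T = "obtuse_target ` {s<..} :: (real ^ 'n ^ 'n) set"
  have zero: "0 \<in> gram_cone E" by (rule gram_coneI[of "\<lambda>i. 0 :: real"]) simp_all
  have disj: "gram_cone E \<inter> ?T = {}"
    using obtuse_target_in_gram_cone[OF E] max by fastforce
  have ne: "gram_cone E \<noteq> {}" "?T \<noteq> {}" using zero by auto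
  obtain a b where a: "a \<noteq> 0" and le: "\<And>Y. Y \<in> gram_cone E \<Longrightarrow> a \<bullet> Y \<le> b"
    and ge: "\<And>Y. Y \<in> ?T \<Longrightarrow> b \<le> a \<bullet> Y"
    using separating_hyperplane_sets[OF convex_gram_cone convex_obtuse_targets ne disj] by blast
  have b: "0 \<le> b" using le[OF zero] by simp
  have dual: "0 \<le> (- a) \<bullet> Y" if Y: "Y \<in> gram_cone E" for Y
  proof (rule ccontr)
    assume "\<not> 0 \<le> (- a) \<bullet> Y"
    then have pos: "a \<bullet> Y > 0" by simp
    \<comment> \<open>The scaled matrix stays in the cone but pairs with \<open>a\<close> to
      \<open>b + 1\<close>, above the separating level.\<close>
    have "a \<bullet> (((b + 1) / (a \<bullet> Y)) *\<^sub>R Y) \<le> b"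
      by (intro le gram_cone_scaleR Y) (use b pos in simp)
    then show False using pos by simp
  qed
  let ?off = "\<Sum>(i, j) | i \<noteq> j. (- a) $ i $ j"
  \<comment> \<open>Since \<open>b \<ge> 0\<close>, the pairing of \<open>- a\<close> with each such
    target is at most zero.\<close>
  have lim: "trace (- a) \<le> t * ?off" if "s < t" for t
    using ge[of "obtuse_target t"] that b inner_obtuse_target[of "- a" t] by simp
  have "((\<lambda>t. t * ?off) \<longlongrightarrow> s * ?off) (at_right s)"
    by (intro tendsto_intros)
  then have "trace (- a) \<le> s * ?off"
    by (rule tendsto_lowerbound) (rule eventually_mono[OF eventually_at_right_less lim], simp_all)
  with a dual show ?thesis by (intro that[of "- a"]) auto
qed

text \<open>Strong duality: the symmetrized certificate is positive semidefinite, so its least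
  eigenvalue is nonnegative and its denominator is at most its trace, which is at most
  \<open>s\<close> times its off-diagonal sum.\<close>

lemma optimal_weight_matrix:
  fixes E :: "('n::finite \<times> 'n) set"
  assumes G: "simple_graph E" and s: "0 < s" and max: "\<And>t v. obtuse_vectors E t v \<Longrightarrow> t \<le> s"
  obtains W where "weight_matrix E W" "weight_denom W \<noteq> 0" "1 / s \<le> weight_ratio W"
proof -
  have irr: "irrefl E" and symE: "\<And>i j. (i, j) \<in> E \<longleftrightarrow> (j, i) \<in> E"
    using G by (auto simp: simple_graph_def sym_def)
  obtain A :: "real ^ 'n ^ 'n" where A0: "A \<noteq> 0" and dual: "\<And>Y. Y \<in> gram_cone E \<Longrightarrow> 0 \<le> A \<bullet> Y"
    and tr: "trace A \<le> s * (\<Sum>(i, j) | i \<noteq> j. A $ i $ j)"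
    using dual_certificate[OF irr] max by metis
  have A_psd: "0 \<le> x \<bullet> (A *v x)" for x
    by (rule dual_cone_gram_cone(1)) (rule dual)
  have A_zero: "A $ i $ j = 0" if "i \<noteq> j" "(i, j) \<notin> E" for i j
    using dual that by (rule dual_cone_gram_cone(3))
  have "0 \<le> A $ i $ j" if "i = j \<or> (i, j) \<in> E" for i j
    using dual that by (rule dual_cone_gram_cone(2))
  then have Ann: "0 \<le> A $ i $ j" for i j
    using A_zero by (metis order_refl)
  \<comment> \<open>The separating normal may fail to be symmetric. Adding the transpose doubles
    both trace and off-diagonal sum, and symmetry of \<open>E\<close> preserves the zero
    pattern.\<close>
  define W where "W = A + transpose A"
  have W: "W $ i $ j = A $ i $ j + A $ j $ i" for i j by (simp add: W_def transpose_def)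
  have sym: "transpose W = W" by (simp add: vec_eq_iff transpose_def W add.commute)
  have wm: "weight_matrix E W"
    using sym Ann A_zero symE unfolding weight_matrix_def W by (metis add.right_neutral add_nonneg_nonneg)
  have psd: "0 \<le> x \<bullet> (W *v x)" for x
    using A_psd[of x] dot_lmul_matrix[of x A x]
    by (simp add: W_def matrix_vector_mult_add_rdistrib inner_add_right inner_commute)
  let ?off = "\<lambda>B :: real ^ 'n ^ 'n. \<Sum>(i, j) | i \<noteq> j. B $ i $ j"
  have "?off (transpose A) = ?off A"
    by (rule sum.reindex_bij_witness[of _ prod.swap prod.swap]) (auto simp: transpose_def)
  then have off: "?off W = 2 * ?off A" by (simp add: W_def sum.distrib split_def)
  have trW: "trace W = 2 * trace A" by (simp add: trace_def W sum_distrib_left)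
  have trA: "0 \<le> trace A" by (simp add: trace_def Ann sum_nonneg)
  \<comment> \<open>A vanishing off-diagonal sum would force the trace to vanish as well; with
    nonnegative entries this gives \<open>A = 0\<close>.\<close>
  have off_pos: "?off A > 0"
  proof (rule ccontr)
    assume "\<not> ?off A > 0"
    moreover have "?off A \<ge> 0" by (rule sum_nonneg) (auto simp: Ann)
    ultimately have "?off A = 0" by simp
    with tr trA have "(\<Sum>i\<in>UNIV. \<Sum>j\<in>UNIV. A $ i $ j) = 0" by (simp add: sum_diag_offdiag trace_def)
    then have "A $ i $ j = 0" for i j
      by (simp add: sum_nonneg_eq_0_iff sum_nonneg Ann)
    with A0 show False by (simp add: vec_eq_iff)
  qed
  have den: "weight_denom W \<noteq> 0"
  proof
    assume "weight_denom W = 0"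
    then obtain c where "W = c *\<^sub>R mat 1" using weight_denom_zero_iff[OF sym] by blast
    then have "?off W = 0" by (auto simp: mat_def intro!: sum.neutral)
    with off off_pos show False by simp
  qed
  then have pos: "weight_denom W > 0" using weight_denom_nonneg[OF sym] by simp
  have "weight_denom W \<le> trace W"
    using lambda_min_nonneg[OF sym psd] by (simp add: weight_denom_def)
  also have "\<dots> \<le> s * ?off W" using tr by (simp add: trW off)
  finally have "1 / s \<le> weight_ratio W" using s pos by (simp add: weight_ratio_def field_simps)
  with wm den show ?thesis by (rule that)
qed

theorem theorem2:
  fixes E :: "('n::finite \<times> 'n) set"
  assumes "simple_graph E" and "E \<noteq> {}"
  shows "(\<exists>W. weight_matrix E W \<and> weight_denom W \<noteq> 0 \<and>
            (\<forall>W'. weight_matrix E W' \<and> weight_denom W' \<noteq> 0 \<longrightarrow> weight_ratio W' \<le> weight_ratio W) \<and>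
            vector_chromatic_number E = 1 + weight_ratio W) \<and>
         (\<forall>W. weight_matrix E W \<longrightarrow> (weight_denom W \<noteq> 0 \<longleftrightarrow> (\<nexists>c. W = c *\<^sub>R mat 1)))"
proof
  have irr: "irrefl E" using assms(1) by (simp add: simple_graph_def)
  obtain s u where s: "0 < s" "s \<le> 1" "obtuse_vectors E s u"
    and max: "\<And>t v. obtuse_vectors E t v \<Longrightarrow> t \<le> s"
    using max_obtuse_vectors[OF irr assms(2)] by metis
  obtain W where W: "weight_matrix E W" "weight_denom W \<noteq> 0" "1 / s \<le> weight_ratio W"
    using optimal_weight_matrix[OF assms(1) s(1)] max by metis
  have ub: "weight_ratio W' \<le> 1 / s" if "weight_matrix E W'" "weight_denom W' \<noteq> 0" for W'
    using weight_ratio_le[OF s(3,1) that] .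
  \<comment> \<open>The two duality bounds meet, so \<open>W\<close> attains the maximum.\<close>
  have "weight_ratio W = 1 / s" using ub[OF W(1,2)] W(3) by simp
  then show "\<exists>W. weight_matrix E W \<and> weight_denom W \<noteq> 0 \<and>
            (\<forall>W'. weight_matrix E W' \<and> weight_denom W' \<noteq> 0 \<longrightarrow> weight_ratio W' \<le> weight_ratio W) \<and>
            vector_chromatic_number E = 1 + weight_ratio W"
    using W(1,2) ub vector_chromatic_number_eq[OF s max] by auto
  show "\<forall>W. weight_matrix E W \<longrightarrow> (weight_denom W \<noteq> 0 \<longleftrightarrow> (\<nexists>c. W = c *\<^sub>R mat 1))"
    by (simp add: weight_matrix_def weight_denom_zero_iff)
qed

end
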